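(* Let $(G,\mu)$ be a finitely generated and symmetric measured group, and let $d$ be the word metric on $G$ with respect to a finite symmetric generating set of $G$, where $\int_G d(g,e)\,d\mu(g)<\infty$. Then $\ell_d(\mu)=0$ if and only if $(G,\mu)$ is Liouville.
   Context: A measured group $(G,\mu)$ is a countable group $G$ together with a probability measure $\mu$ on $G$ whose support generates $G$ as a semigroup. Write $\check\mu(g)=\mu(g^{-1})$; $(G,\mu)$ is symmetric if $\check\mu=\mu$. $\mu^{*n}$ denotes the $n$-th convolution power of $\mu$, and $e$ is the identity of $G$. Given a left $G$-invariant metric $d$ on $G$ that is $\mu$-integrable, i.e. $\int_G d(g,e)\,d\mu(g)<\infty$, the drift is $$\ell_d(\mu)=\lim_{n\to\infty}\frac1n\int_G d(g,e)\,d\mu^{*n}(g)$$ (the limit exists and is finite by subadditivity). A bounded function $f:G\to\mathbb{C}$ is left $\mu$-harmonic if $f(g)=\int_G f(sg)\,d\check\mu(s)$ for all $g\in G$. $(G,\mu)$ is Liouville if every bounded left $\mu$-harmonic function on $G$ is constant. *)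

theory Defs
  imports "HOL-Probability.Probability" "HOL-Algebra.Generated_Groups"
begin

inductive_set semigroup_generate :: "('a, 'b) monoid_scheme \<Rightarrow> 'a set \<Rightarrow> 'a set"
  for G and A where
  incl: "a \<in> A \<Longrightarrow> a \<in> semigroup_generate G A"
| mult: "a \<in> semigroup_generate G A \<Longrightarrow> b \<in> semigroup_generate G A
    \<Longrightarrow> a \<otimes>\<^bsub>G\<^esub> b \<in> semigroup_generate G A"

text \<open>A probability measure on a countable (discrete) group is a probability mass function;
  it lives on the ambient type and is required to be supported in the carrier.\<close>

locale measured_group = group G for G (structure) +
  fixes \<mu> :: "'a pmf"
  assumes countable_carrier: "countable (carrier G)"
    and support_carrier: "set_pmf \<mu> \<subseteq> carrier G"
    and support_generates: "semigroup_generate G (set_pmf \<mu>) = carrier G"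

text \<open>The measure \<open>g \<mapsto> \<mu>(g\<inverse>)\<close>, as the image of \<open>\<mu>\<close> under inversion;
  see \<open>pmf_reflected\<close>.\<close>

definition reflected :: "('a, 'b) monoid_scheme \<Rightarrow> 'a pmf \<Rightarrow> 'a pmf" where
  "reflected G \<mu> = map_pmf (m_inv G) \<mu>"

definition symmetric_measure :: "('a, 'b) monoid_scheme \<Rightarrow> 'a pmf \<Rightarrow> bool" where
  "symmetric_measure G \<mu> \<longleftrightarrow> reflected G \<mu> = \<mu>"

definition convolution_pmf :: "('a, 'b) monoid_scheme \<Rightarrow> 'a pmf \<Rightarrow> 'a pmf \<Rightarrow> 'a pmf" where
  "convolution_pmf G \<mu> \<nu> = map_pmf (\<lambda>(x, y). x \<otimes>\<^bsub>G\<^esub> y) (pair_pmf \<mu> \<nu>)"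

primrec conv_power :: "('a, 'b) monoid_scheme \<Rightarrow> 'a pmf \<Rightarrow> nat \<Rightarrow> 'a pmf" where
  "conv_power G \<mu> 0 = return_pmf \<one>\<^bsub>G\<^esub>"
| "conv_power G \<mu> (Suc n) = convolution_pmf G \<mu> (conv_power G \<mu> n)"

definition drift :: "('a, 'b) monoid_scheme \<Rightarrow> ('a \<Rightarrow> 'a \<Rightarrow> real) \<Rightarrow> 'a pmf \<Rightarrow> real" where
  "drift G d \<mu> =
     lim (\<lambda>n. 1 / real n * measure_pmf.expectation (conv_power G \<mu> n) (\<lambda>g. d g \<one>\<^bsub>G\<^esub>))"

definition left_harmonic :: "('a, 'b) monoid_scheme \<Rightarrow> 'a pmf \<Rightarrow> ('a \<Rightarrow> complex) \<Rightarrow> bool" where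
  "left_harmonic G \<mu> f \<longleftrightarrow>
     (\<forall>g\<in>carrier G. f g = measure_pmf.expectation (reflected G \<mu>) (\<lambda>s. f (s \<otimes>\<^bsub>G\<^esub> g)))"

definition liouville :: "('a, 'b) monoid_scheme \<Rightarrow> 'a pmf \<Rightarrow> bool" where
  "liouville G \<mu> \<longleftrightarrow>
     (\<forall>f. bounded (f ` carrier G) \<longrightarrow> left_harmonic G \<mu> f \<longrightarrow> f constant_on carrier G)"

definition symmetric_generating_set :: "('a, 'b) monoid_scheme \<Rightarrow> 'a set \<Rightarrow> bool" where
  "symmetric_generating_set G S \<longleftrightarrow>
     S \<subseteq> carrier G \<and> (\<forall>s\<in>S. inv\<^bsub>G\<^esub> s \<in> S) \<and> generate G S = carrier G"

definition word_length :: "('a, 'b) monoid_scheme \<Rightarrow> 'a set \<Rightarrow> 'a \<Rightarrow> nat" where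
  "word_length G S g =
     (LEAST n. \<exists>ws. length ws = n \<and> set ws \<subseteq> S \<and> foldr (mult G) ws \<one>\<^bsub>G\<^esub> = g)"

definition word_metric :: "('a, 'b) monoid_scheme \<Rightarrow> 'a set \<Rightarrow> 'a \<Rightarrow> 'a \<Rightarrow> real" where
  "word_metric G S g h = real (word_length G S (inv\<^bsub>G\<^esub> g \<otimes>\<^bsub>G\<^esub> h))"

lemma (in measured_group) pmf_reflected:
  assumes "g \<in> carrier G"
  shows "pmf (reflected G \<mu>) g = pmf \<mu> (inv g)"
proof -
  have "pmf (reflected G \<mu>) g = measure \<mu> (m_inv G -` {g})"
    by (simp add: reflected_def pmf_map)
  also have "\<dots> = measure \<mu> {inv g}"
    using assms support_carrier
    by (intro measure_pmf.finite_measure_eq_AE) (auto simp: AE_measure_pmf_iff)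
  also have "\<dots> = pmf \<mu> (inv g)"
    by (simp add: measure_pmf_single)
  finally show ?thesis .
qed

end

theory Submission
  imports Defs "HOL-Complex_Analysis.Great_Picard"
begin

text \<open>
  Let \<open>X\<^sub>n\<close> have law \<open>\<mu>\<^sup>*\<^sup>n\<close> and write \<open>|g|\<close> for the word length.

  \<^emph>\<open>Zero drift implies Liouville.\<close> If \<open>u\<close> is bounded with \<open>u(h) = E u(h X\<^sub>1)\<close> and \<open>u(hs) \<noteq> u(h)\<close>
  for some \<open>s\<close> in the support of \<open>\<mu>\<close>, then testing the relative entropy of \<open>\<delta>\<^sub>s * \<mu>\<^sup>*\<^sup>n\<close> with respect to
  \<open>\<mu> * \<mu>\<^sup>*\<^sup>n\<close> against the function \<open>x \<mapsto> u(hx)\<close> shows that the entropy of \<open>\<mu>\<^sup>*\<^sup>n\<close> grows by at least a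
  fixed positive amount at each step. Since balls grow at most exponentially, the entropy of \<open>X\<^sub>n\<close>
  is at most \<open>K (E|X\<^sub>n| + 1)\<close>, so the drift is positive.

  \<^emph>\<open>Liouville implies zero drift\<close> (after Erschler and Karlsson). Let \<open>\<phi>\<close> be a pointwise subsequential
  limit of the Cesaro means of \<open>E(|g X\<^sub>n| - |X\<^sub>n|)\<close>. For fixed \<open>g\<close> the function
  \<open>h \<mapsto> \<phi>(gh) - \<phi>(h)\<close> is bounded and harmonic, hence constant, so \<open>\<phi>\<close> is a homomorphism to the reals.
  Its \<open>\<mu>\<close>-mean vanishes by symmetry, but telescoping shows that it equals the drift.
\<close>

section \<open>Subadditive sequences and iterated expectations\<close>

text \<open>Fekete's lemma: the limit is the infimum of \<open>a n / n\<close>. Dividing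
  \<open>n\<close> by a fixed \<open>m\<close> with remainder, subadditivity bounds
  \<open>a n\<close> by \<open>n div m\<close> copies of \<open>a m\<close> plus a remainder term
  that stays bounded.\<close>

lemma subadditive_convergent:
  fixes a :: "nat \<Rightarrow> real"
  assumes sub: "\<And>m n. a (m + n) \<le> a m + a n" and nonneg: "\<And>n. 0 \<le> a n"
  shows "convergent (\<lambda>n. 1 / real n * a n)"
proof -
  define L where "L = (INF n\<in>{1..}. a n / real n)"
  have bdd: "bdd_below ((\<lambda>n. a n / real n) ` {1..})"
    by (rule bdd_belowI[of _ 0]) (auto simp: nonneg)
  have mult: "a (m * q + r) \<le> real q * a m + a r" for m q r
  proof (induction q)
    case (Suc q)
    have "a (m * Suc q + r) \<le> a m + a (m * q + r)"
      using sub[of m "m * q + r"] by (simp add: algebra_simps)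
    with Suc show ?case by (simp add: algebra_simps)
  qed simp
  have "(\<lambda>n. a n / real n) \<longlonglongrightarrow> L"
  proof (rule LIMSEQ_I)
    fix e :: real assume "0 < e"
    obtain m where m: "m \<ge> 1" "a m / real m < L + e / 2"
      using cINF_less_iff[OF _ bdd, of "L + e / 2"] \<open>0 < e\<close> unfolding L_def by auto
    \<comment> \<open>By nonnegativity this sum dominates every possible remainder term at
      once.\<close>
    define C where "C = (\<Sum>r<m. a r)"
    have C: "a r \<le> C" if "r < m" for r
      unfolding C_def using that by (intro member_le_sum) (auto simp: nonneg)
    obtain N :: nat where N: "2 * C / e < real N" using reals_Archimedean2 by blast
    have "norm (a n / real n - L) < e" if n: "n \<ge> max 1 N" for n
    proof -
      have "0 < real n" using n by simp
      have "a n \<le> real (n div m) * a m + a (n mod m)"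
        using mult[of m "n div m" "n mod m"] by simp
      also have "\<dots> \<le> real n / real m * a m + C"
        using m C[of "n mod m"] by (intro add_mono mult_right_mono nonneg of_nat_div_le_of_nat) auto
      finally have "a n / real n \<le> (real n / real m * a m + C) / real n"
        by (intro divide_right_mono) auto
      also have "\<dots> = a m / real m + C / real n"
        using \<open>0 < real n\<close> by (simp add: field_simps)
      finally have "a n / real n \<le> a m / real m + C / real n" .
      moreover have "C / real n < e / 2"
      proof -
        have "2 * C / e < real n" using N n by simp
        then show ?thesis using \<open>0 < e\<close> \<open>0 < real n\<close> by (simp add: field_simps)
      qed
      moreover have "L \<le> a n / real n"
        unfolding L_def using n by (intro cINF_lower bdd) auto
      ultimately show ?thesis using m(2) unfolding real_norm_def by linarith
    qed
    then show "\<exists>N. \<forall>n\<ge>N. norm (a n / real n - L) < e" by blast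
  qed
  then show ?thesis by (auto simp: convergent_def)
qed

text \<open>Tonelli's theorem carried over to Bochner integrals: integrability over the mixture
  makes the inner nonnegative integral finite for almost every \<open>s\<close>, and there the two
  kinds of integral agree.\<close>

lemma integral_bind_pmf_nonneg:
  fixes f :: "'b \<Rightarrow> real"
  assumes int: "integrable (bind_pmf M N) f" and nonneg: "\<And>x. 0 \<le> f x"
  shows "integrable M (\<lambda>s. measure_pmf.expectation (N s) f)" (is ?A)
    and "measure_pmf.expectation (bind_pmf M N) f
      = measure_pmf.expectation M (\<lambda>s. measure_pmf.expectation (N s) f)" (is ?B)
proof -
  have fin: "(\<integral>\<^sup>+s. (\<integral>\<^sup>+x. ennreal (f x) \<partial>N s) \<partial>M) = ennreal (measure_pmf.expectation (bind_pmf M N) f)"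
    using nn_integral_eq_integral[OF int] nonneg by simp
  then have "AE s in M. (\<integral>\<^sup>+x. ennreal (f x) \<partial>N s) \<noteq> \<infinity>"
    by (intro nn_integral_PInf_AE) auto
  then have inner: "AE s in M. (\<integral>\<^sup>+x. ennreal (f x) \<partial>N s) = ennreal (measure_pmf.expectation (N s) f)"
  proof eventually_elim
    case (elim s)
    then have "integrable (N s) f"
      by (intro integrableI_nonneg) (auto simp: nonneg top.not_eq_extremum)
    then show ?case using nonneg by (intro nn_integral_eq_integral) auto
  qed
  have eq: "(\<integral>\<^sup>+s. ennreal (measure_pmf.expectation (N s) f) \<partial>M)
    = ennreal (measure_pmf.expectation (bind_pmf M N) f)"
    unfolding fin[symmetric] using inner by (intro nn_integral_cong_AE) auto
  have nn: "0 \<le> measure_pmf.expectation (N s) f" for s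
    by (simp add: nonneg)
  show ?A
    by (rule integrableI_nonneg) (auto simp: nonneg eq)
  then have "(\<integral>\<^sup>+s. ennreal (measure_pmf.expectation (N s) f) \<partial>M)
      = ennreal (measure_pmf.expectation M (\<lambda>s. measure_pmf.expectation (N s) f))"
    using nn by (intro nn_integral_eq_integral) auto
  with eq show ?B by (simp add: nonneg)
qed

lemma integrable_measure_pmf_bounded:
  fixes f :: "'b \<Rightarrow> real"
  assumes "\<And>x. \<bar>f x\<bar> \<le> B"
  shows "integrable (measure_pmf p) f"
  by (rule measure_pmf.integrable_const_bound[where B=B]) (auto simp: assms)

lemma abs_integral_measure_pmf_le:
  fixes f :: "'b \<Rightarrow> real"
  assumes "\<And>x. x \<in> set_pmf p \<Longrightarrow> \<bar>f x\<bar> \<le> B"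
  shows "\<bar>measure_pmf.expectation p f\<bar> \<le> B"
proof -
  have ae: "AE x in p. \<bar>f x\<bar> \<le> B" using assms by (simp add: AE_measure_pmf_iff)
  have int: "integrable p f"
    using ae by (intro measure_pmf.integrable_const_bound[where B=B]) auto
  have "measure_pmf.expectation p f \<le> B"
    using ae by (intro measure_pmf.integral_le_const int) auto
  moreover have "- B \<le> measure_pmf.expectation p f"
    using ae by (intro measure_pmf.integral_ge_const int) auto
  ultimately show ?thesis by auto
qed

text \<open>Adding the bound \<open>B\<close> makes the function nonnegative, which reduces to the
  previous case; the constant then cancels.\<close>

lemma integral_bind_pmf_bounded:
  fixes f :: "'b \<Rightarrow> real"
  assumes B: "\<And>x. \<bar>f x\<bar> \<le> B"
  shows "measure_pmf.expectation (bind_pmf M N) f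
      = measure_pmf.expectation M (\<lambda>s. measure_pmf.expectation (N s) f)"
proof -
  have int: "integrable (measure_pmf p) f" for p
    using B by (rule integrable_measure_pmf_bounded)
  have "measure_pmf.expectation (bind_pmf M N) (\<lambda>x. f x + B)
      = measure_pmf.expectation M (\<lambda>s. measure_pmf.expectation (N s) (\<lambda>x. f x + B))"
  proof (rule integral_bind_pmf_nonneg(2))
    show "0 \<le> f x + B" for x using B[of x] by linarith
  qed (simp add: int)
  moreover have "integrable M (\<lambda>s. measure_pmf.expectation (N s) f)"
    by (rule integrable_measure_pmf_bounded[where B=B]) (rule abs_integral_measure_pmf_le, rule B)
  ultimately show ?thesis
    by (simp add: int)
qed

section \<open>Entropy\<close>

text \<open>Shannon entropy in natural units. It takes values in \<open>ennreal\<close>, so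
  entropies can be compared before they are known to be finite.\<close>

definition entropy_pmf :: "'b pmf \<Rightarrow> ennreal" where
  "entropy_pmf p = (\<integral>\<^sup>+x. ennreal (- ln (pmf p x)) \<partial>p)"

text \<open>Change of measure by the density of \<open>q\<close> relative to \<open>p\<close>. It is
  only an inequality because the mass of \<open>q\<close> outside the support of \<open>p\<close> is
  lost.\<close>

lemma nn_integral_pmf_ratio_le:
  fixes p q :: "'b pmf"
  shows "(\<integral>\<^sup>+x. ennreal (pmf q x / pmf p x) * w x \<partial>p) \<le> (\<integral>\<^sup>+x. w x \<partial>q)"
proof -
  have "ennreal (pmf p x) * (ennreal (pmf q x / pmf p x) * w x) \<le> ennreal (pmf q x) * w x" for x
    by (cases "pmf p x = 0") (auto simp: ennreal_mult[symmetric] mult.assoc[symmetric])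
  then show ?thesis
    unfolding nn_integral_measure_pmf by (intro nn_integral_mono) auto
qed

lemma ln_pmf_le_0: "ln (pmf p x) \<le> 0"
  by (cases "pmf p x = 0") (auto simp: pmf_le_1 pmf_positive_iff set_pmf_iff)

text \<open>The Donsker--Varadhan lower bound for the relative entropy of \<open>p\<close> with respect to \<open>q\<close>,
  with all terms moved to the side where they are nonnegative, so that no integrability is needed.\<close>

lemma entropy_pmf_variational:
  fixes F :: "'b \<Rightarrow> real" and p q :: "'b pmf"
  assumes sub: "set_pmf p \<subseteq> set_pmf q" and C: "\<And>x. \<bar>F x\<bar> \<le> C"
  shows "entropy_pmf p + ennreal (measure_pmf.expectation p F + C + 1)
    \<le> (\<integral>\<^sup>+x. ennreal (- ln (pmf q x)) \<partial>p) + ennreal C + (\<integral>\<^sup>+x. ennreal (exp (F x)) \<partial>q)"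
proof -
  have C0: "0 \<le> C" using C[of undefined] by linarith
  have FC: "0 \<le> F x + C + 1" for x using C[of x] by linarith
  have pointwise: "- ln (pmf p x) + (F x + C + 1)
      \<le> - ln (pmf q x) + C + pmf q x / pmf p x * exp (F x)" if "x \<in> set_pmf p" for x
  proof -
    have pos: "0 < pmf p x" "0 < pmf q x" using that sub by (auto simp: pmf_positive_iff)
    \<comment> \<open>The inequality \<open>ln t \<le> t - 1\<close> at this \<open>t\<close> is the
      whole content of the bound. Its \<open>1\<close>, together with the \<open>C\<close> that
      makes \<open>F x + C\<close> nonnegative, explains the shift \<open>C + 1\<close>.\<close>
    have "ln (pmf q x / pmf p x * exp (F x)) \<le> pmf q x / pmf p x * exp (F x) - 1"
      using pos by (intro ln_le_minus_one) auto
    then show ?thesis using pos by (simp add: ln_mult ln_div)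
  qed
  have "integrable p F" using C by (rule integrable_measure_pmf_bounded)
  then have "(\<integral>\<^sup>+x. ennreal (F x + C + 1) \<partial>p) = ennreal (measure_pmf.expectation p F + C + 1)"
    using FC by (subst nn_integral_eq_integral) auto
  then have "entropy_pmf p + ennreal (measure_pmf.expectation p F + C + 1)
      = (\<integral>\<^sup>+x. ennreal (- ln (pmf p x)) + ennreal (F x + C + 1) \<partial>p)"
    unfolding entropy_pmf_def by (subst nn_integral_add) auto
  also have "\<dots> \<le> (\<integral>\<^sup>+x. ennreal (- ln (pmf q x)) + ennreal C
      + ennreal (pmf q x / pmf p x) * ennreal (exp (F x)) \<partial>p)"
  proof (rule nn_integral_mono_AE, unfold AE_measure_pmf_iff, safe)
    fix x assume "x \<in> set_pmf p"
    then show "ennreal (- ln (pmf p x)) + ennreal (F x + C + 1) \<le> ennreal (- ln (pmf q x)) + ennreal C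
      + ennreal (pmf q x / pmf p x) * ennreal (exp (F x))"
      using pointwise[of x] FC[of x] C0 ln_pmf_le_0[of p x] ln_pmf_le_0[of q x]
      by (simp add: ennreal_mult[symmetric] ennreal_plus[symmetric] del: ennreal_plus)
  qed
  also have "\<dots> = (\<integral>\<^sup>+x. ennreal (- ln (pmf q x)) \<partial>p) + ennreal C
      + (\<integral>\<^sup>+x. ennreal (pmf q x / pmf p x) * ennreal (exp (F x)) \<partial>p)"
    by (simp add: nn_integral_add)
  also have "\<dots> \<le> (\<integral>\<^sup>+x. ennreal (- ln (pmf q x)) \<partial>p) + ennreal C + (\<integral>\<^sup>+x. ennreal (exp (F x)) \<partial>q)"
    by (intro add_left_mono nn_integral_pmf_ratio_le)
  finally show ?thesis .
qed

text \<open>Gibbs' inequality, the case \<open>F = 0\<close> and \<open>C = 0\<close> of the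
  variational bound.\<close>

lemma entropy_pmf_le_cross_entropy:
  fixes p q :: "'b pmf"
  assumes "set_pmf p \<subseteq> set_pmf q"
  shows "entropy_pmf p \<le> (\<integral>\<^sup>+x. ennreal (- ln (pmf q x)) \<partial>p)"
  using entropy_pmf_variational[OF assms, of "\<lambda>_. 0" 0] ennreal_add_left_cancel_le[of 1]
  by (simp add: add.commute)

text \<open>Since \<open>1 - t \<le> exp (- t)\<close>, it suffices that the right-hand side times
  \<open>1 - t\<close> is at least \<open>1\<close>; that product equals
  \<open>1 + t^2 * (1 - 2 * t)\<close>.\<close>

lemma exp_le_quadratic:
  fixes t :: real
  assumes "\<bar>t\<bar> \<le> 1 / 2"
  shows "exp t \<le> 1 + t + 2 * t\<^sup>2"
proof -
  have "0 \<le> t\<^sup>2 * (1 - 2 * t)" using assms by (intro mult_nonneg_nonneg) auto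
  then have "1 \<le> (1 + t + 2 * t\<^sup>2) * (1 - t)"
    by (simp add: algebra_simps power2_eq_square)
  also have "\<dots> \<le> (1 + t + 2 * t\<^sup>2) * exp (- t)"
    using exp_ge_add_one_self[of "- t"] assms zero_le_power2[of t]
    by (intro mult_left_mono) (auto simp: abs_le_iff)
  finally show ?thesis by (simp add: exp_minus field_simps)
qed

text \<open>A quantitative Gibbs inequality in the spirit of Pinsker: a bounded function whose means
  under \<open>p\<close> and \<open>q\<close> differ by \<open>\<delta>\<close> forces a gap of
  order \<open>\<delta>^2\<close>. The variational bound is applied to a small multiple of
  \<open>F\<close>, with the exponential estimated to second order.\<close>

lemma entropy_pmf_gain:
  fixes p q :: "'b pmf"
  assumes sub: "set_pmf p \<subseteq> set_pmf q" and B: "\<And>x. \<bar>F x\<bar> \<le> B" "0 < B"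
    and mean: "measure_pmf.expectation q F = 0" and \<delta>: "measure_pmf.expectation p F = \<delta>"
  shows "entropy_pmf p + ennreal (\<delta>\<^sup>2 / (8 * B\<^sup>2)) \<le> (\<integral>\<^sup>+x. ennreal (- ln (pmf q x)) \<partial>p)"
proof -
  \<comment> \<open>This value maximises the gain
    \<open>\<epsilon> * \<delta> - 2 * (\<epsilon> * B)^2\<close>, and the maximum is
    \<open>\<delta>^2 / (8 * B^2)\<close>.\<close>
  define \<epsilon> where "\<epsilon> = \<delta> / (4 * B\<^sup>2)"
  define E where "E = (\<lambda>x. \<epsilon> * F x)"
  have int: "integrable (measure_pmf r) F" for r
    using B by (intro integrable_measure_pmf_bounded)
  have "\<bar>\<delta>\<bar> \<le> B" unfolding \<delta>[symmetric] by (intro abs_integral_measure_pmf_le B)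
  then have "\<bar>\<epsilon>\<bar> * B \<le> 1 / 4"
    using B(2) by (simp add: \<epsilon>_def abs_mult field_simps power2_eq_square)
  then have E: "\<bar>E x\<bar> \<le> 1 / 4" for x
    using mult_left_mono[OF B(1)[of x], of "\<bar>\<epsilon>\<bar>"] by (simp add: E_def abs_mult)
  have "exp (E x) \<le> 1 + E x + 2 * (\<epsilon> * B)\<^sup>2" for x
  proof -
    have "exp (E x) \<le> 1 + E x + 2 * (E x)\<^sup>2" using E[of x] by (intro exp_le_quadratic) simp
    moreover have "(E x)\<^sup>2 \<le> (\<epsilon> * B)\<^sup>2"
      unfolding E_def power_mult_distrib using B(1)[of x] by (intro mult_left_mono) (auto simp: abs_le_square_iff[symmetric])
    ultimately show ?thesis by simp
  qed
  then have "(\<integral>\<^sup>+x. ennreal (exp (E x)) \<partial>q) \<le> (\<integral>\<^sup>+x. ennreal (1 + E x + 2 * (\<epsilon> * B)\<^sup>2) \<partial>q)"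
    by (intro nn_integral_mono ennreal_leI)
  also have "\<dots> = ennreal (1 + 2 * (\<epsilon> * B)\<^sup>2)"
  proof (subst nn_integral_eq_integral)
    have "0 \<le> 1 + E x + 2 * (\<epsilon> * B)\<^sup>2" for x
      using E[of x] zero_le_power2[of "\<epsilon> * B"] by (simp add: abs_le_iff del: zero_le_power2)
    then show "AE x in q. 0 \<le> 1 + E x + 2 * (\<epsilon> * B)\<^sup>2" by simp
  qed (auto simp: E_def int mean)
  finally have exp_q: "(\<integral>\<^sup>+x. ennreal (exp (E x)) \<partial>q) \<le> ennreal (1 + 2 * (\<epsilon> * B)\<^sup>2)" .
  have exp_p: "measure_pmf.expectation p E = \<epsilon> * \<delta>" by (simp add: E_def \<delta>)
  \<comment> \<open>\<open>?m\<close> collects the shift \<open>1 / 4 + 1\<close> and the quadratic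
    error. Being finite, it can be cancelled in \<open>ennreal\<close> at the end.\<close>
  let ?c = "\<delta>\<^sup>2 / (8 * B\<^sup>2)" and ?m = "1 / 4 + 1 + 2 * (\<epsilon> * B)\<^sup>2"
  have gain: "\<epsilon> * \<delta> + 1 / 4 + 1 = ?c + ?m"
    using B(2) by (simp add: \<epsilon>_def field_simps power2_eq_square)
  have "ennreal ?m + (entropy_pmf p + ennreal ?c) = entropy_pmf p + ennreal (?c + ?m)"
    by (simp add: ennreal_plus[symmetric] ac_simps del: ennreal_plus)
  also have "\<dots> \<le> (\<integral>\<^sup>+x. ennreal (- ln (pmf q x)) \<partial>p) + ennreal (1 / 4) + (\<integral>\<^sup>+x. ennreal (exp (E x)) \<partial>q)"
    using entropy_pmf_variational[OF sub, of E "1 / 4"] E unfolding exp_p gain by simp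
  also have "\<dots> \<le> (\<integral>\<^sup>+x. ennreal (- ln (pmf q x)) \<partial>p) + ennreal (1 / 4) + ennreal (1 + 2 * (\<epsilon> * B)\<^sup>2)"
    by (intro add_left_mono exp_q)
  also have "\<dots> = ennreal ?m + (\<integral>\<^sup>+x. ennreal (- ln (pmf q x)) \<partial>p)"
    by (simp add: ennreal_plus[symmetric] ac_simps del: ennreal_plus)
  finally show ?thesis by (simp only: ennreal_add_left_cancel_le) simp
qed

text \<open>The entropy of a mixture is the average of the cross entropies of its components against
  it. Gibbs' inequality bounds each component below by \<open>H\<close>, and the component
  \<open>s\<close> contributes its extra gap with weight \<open>pmf M s\<close>.\<close>

lemma entropy_pmf_mixture_gain:
  fixes P :: "'c \<Rightarrow> 'b pmf"
  assumes H: "\<And>s. s \<in> set_pmf M \<Longrightarrow> entropy_pmf (P s) = H"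
    and B: "\<And>x. \<bar>F x\<bar> \<le> B" "0 < B"
    and mean: "measure_pmf.expectation (bind_pmf M P) F = 0"
    and \<delta>: "measure_pmf.expectation (P s) F = \<delta>" and s: "s \<in> set_pmf M"
  shows "H + ennreal (pmf M s * (\<delta>\<^sup>2 / (8 * B\<^sup>2))) \<le> entropy_pmf (bind_pmf M P)"
proof -
  let ?q = "bind_pmf M P" and ?c = "\<delta>\<^sup>2 / (8 * B\<^sup>2)"
  have indicator: "(\<integral>\<^sup>+t. ennreal ?c * indicator {s} t \<partial>M) = ennreal (pmf M s * ?c)"
    by (subst nn_integral_cmult_indicator) (auto simp: emeasure_pmf_single ennreal_mult[symmetric] mult.commute)
  have "H + ennreal (pmf M s * ?c) = (\<integral>\<^sup>+t. H + ennreal ?c * indicator {s} t \<partial>M)"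
    using indicator by (subst nn_integral_add) auto
  also have "\<dots> \<le> (\<integral>\<^sup>+t. (\<integral>\<^sup>+x. ennreal (- ln (pmf ?q x)) \<partial>P t) \<partial>M)"
  proof (rule nn_integral_mono_AE, unfold AE_measure_pmf_iff, safe)
    fix t assume t: "t \<in> set_pmf M"
    then have sub: "set_pmf (P t) \<subseteq> set_pmf ?q" by auto
    show "H + ennreal ?c * indicator {s} t \<le> (\<integral>\<^sup>+x. ennreal (- ln (pmf ?q x)) \<partial>P t)"
    proof (cases "t = s")
      case True
      then show ?thesis using entropy_pmf_gain[OF sub B mean] \<delta> H[OF t] by simp
    next
      case False
      then show ?thesis using entropy_pmf_le_cross_entropy[OF sub] H[OF t] by simp
    qed
  qed
  also have "\<dots> = entropy_pmf ?q" by (simp add: entropy_pmf_def)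
  finally show ?thesis .
qed

text \<open>Relabelling atoms preserves entropy; the relabellings of interest are left
  translations.\<close>

lemma entropy_pmf_map_inj:
  assumes "inj_on f (set_pmf p)"
  shows "entropy_pmf (map_pmf f p) = entropy_pmf p"
  unfolding entropy_pmf_def nn_integral_map_pmf
  by (rule nn_integral_cong_AE) (simp add: AE_measure_pmf_iff pmf_map_inj[OF assms])

section \<open>Convolution and word length\<close>

lemma pmf_le_pmf_map: "pmf p x \<le> pmf (map_pmf f p) (f x)"
proof -
  have "measure (measure_pmf p) {x} \<le> measure (measure_pmf p) (f -` {f x})"
    by (intro measure_pmf.finite_measure_mono) auto
  then show ?thesis by (simp add: pmf_map measure_pmf_single)
qed

lemma pmf_mult_le_pmf_bind: "pmf M s * pmf (N s) x \<le> pmf (bind_pmf M N) x"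
proof -
  have "pmf M s * pmf (N s) x = measure_pmf.expectation M (\<lambda>t. indicator {s} t * pmf (N s) x)"
    by (simp add: measure_pmf_single)
  also have "\<dots> \<le> measure_pmf.expectation M (\<lambda>t. pmf (N t) x)"
    by (intro integral_mono integrable_measure_pmf_bounded[where B=1])
      (auto simp: indicator_def pmf_le_1)
  finally show ?thesis by (simp add: pmf_bind)
qed

context group begin

text \<open>Conditioning on the first factor exhibits a convolution as a mixture of left translates,
  the form to which the mixture estimate and iterated expectation apply.\<close>

lemma convolution_pmf_bind:
  "convolution_pmf G p q = bind_pmf p (\<lambda>s. map_pmf (\<lambda>x. s \<otimes> x) q)"
  by (simp add: convolution_pmf_def pair_pmf_def map_pmf_def bind_assoc_pmf bind_return_pmf)

lemma set_convolution_pmf: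
  assumes "set_pmf p \<subseteq> carrier G" "set_pmf q \<subseteq> carrier G"
  shows "set_pmf (convolution_pmf G p q) \<subseteq> carrier G"
  using assms by (auto simp: convolution_pmf_bind)

lemma convolution_pmf_assoc:
  assumes "set_pmf p \<subseteq> carrier G" "set_pmf q \<subseteq> carrier G" "set_pmf r \<subseteq> carrier G"
  shows "convolution_pmf G (convolution_pmf G p q) r = convolution_pmf G p (convolution_pmf G q r)"
  unfolding convolution_pmf_bind bind_assoc_pmf map_bind_pmf bind_map_pmf pmf.map_comp
  using assms by (intro bind_pmf_cong map_pmf_cong refl) (auto simp: m_assoc subset_iff)

lemma set_conv_power:
  assumes "set_pmf p \<subseteq> carrier G"
  shows "set_pmf (conv_power G p n) \<subseteq> carrier G"
  by (induction n) (simp_all add: set_convolution_pmf assms)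

lemma conv_power_add:
  assumes "set_pmf p \<subseteq> carrier G"
  shows "conv_power G p (m + n) = convolution_pmf G (conv_power G p m) (conv_power G p n)"
proof (induction m)
  case 0
  have "map_pmf (\<lambda>x. \<one> \<otimes> x) (conv_power G p n) = map_pmf id (conv_power G p n)"
    using set_conv_power[OF assms, of n] by (intro map_pmf_cong) auto
  then show ?case by (simp add: convolution_pmf_bind bind_return_pmf)
next
  case (Suc m)
  then show ?case by (simp add: convolution_pmf_assoc assms set_conv_power)
qed

lemma pmf_mult_le_pmf_convolution: "pmf p a * pmf q b \<le> pmf (convolution_pmf G p q) (a \<otimes> b)"
  using pmf_le_pmf_map[of "pair_pmf p q" "(a, b)" "\<lambda>(x, y). x \<otimes> y"]
  by (simp add: convolution_pmf_def pmf_pair)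

lemma foldr_mult_closed: "set ws \<subseteq> carrier G \<Longrightarrow> foldr (\<otimes>) ws \<one> \<in> carrier G"
  by (induction ws) auto

lemma foldr_mult_append:
  assumes "set us \<subseteq> carrier G" "set vs \<subseteq> carrier G"
  shows "foldr (\<otimes>) (us @ vs) \<one> = foldr (\<otimes>) us \<one> \<otimes> foldr (\<otimes>) vs \<one>"
  using assms by (induction us) (auto simp: m_assoc foldr_mult_closed simp del: foldr_append simp: append_Cons)

lemma foldr_mult_inv:
  assumes "set ws \<subseteq> carrier G"
  shows "foldr (\<otimes>) (rev (map (m_inv G) ws)) \<one> = inv (foldr (\<otimes>) ws \<one>)"
  using assms
proof (induction ws)
  case (Cons w ws)
  then have "set (map (m_inv G) ws) \<subseteq> carrier G" by auto
  with Cons show ?case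
    by (simp add: foldr_mult_append foldr_mult_closed inv_mult_group del: foldr_append)
qed simp

end

section \<open>Word length and the entropy bound it provides\<close>

locale finitely_generated_group = group G for G (structure) +
  fixes S :: "'a set"
  assumes finite_S: "finite S" and symmetric_S: "symmetric_generating_set G S"
begin

abbreviation len :: "'a \<Rightarrow> real" where "len g \<equiv> real (word_length G S g)"

lemma S_carrier: "S \<subseteq> carrier G"
  using symmetric_S by (simp add: symmetric_generating_set_def)

lemma inv_S: "s \<in> S \<Longrightarrow> inv s \<in> S"
  using symmetric_S by (simp add: symmetric_generating_set_def)

lemma ex_word:
  assumes "g \<in> carrier G"
  shows "\<exists>ws. set ws \<subseteq> S \<and> foldr (\<otimes>) ws \<one> = g"
proof -
  have "g \<in> generate G S" using assms symmetric_S by (simp add: symmetric_generating_set_def)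
  then show ?thesis
  proof induction
    case one
    show ?case by (rule exI[of _ "[]"]) simp
  next
    case (incl h)
    then show ?case using S_carrier by (intro exI[of _ "[h]"]) auto
  next
    case (inv h)
    then show ?case using S_carrier inv_S by (intro exI[of _ "[inv h]"]) auto
  next
    case (eng h1 h2)
    then obtain us vs where "set us \<subseteq> S" "foldr (\<otimes>) us \<one> = h1" "set vs \<subseteq> S" "foldr (\<otimes>) vs \<one> = h2"
      by blast
    then show ?case using S_carrier
      by (intro exI[of _ "us @ vs"]) (auto simp: foldr_mult_append simp del: foldr_append)
  qed
qed

lemma word_length_le: "set ws \<subseteq> S \<Longrightarrow> word_length G S (foldr (\<otimes>) ws \<one>) \<le> length ws"
  unfolding word_length_def by (rule Least_le) blast

lemma geodesic_word:
  assumes "g \<in> carrier G"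
  obtains ws where "set ws \<subseteq> S" "foldr (\<otimes>) ws \<one> = g" "length ws = word_length G S g"
proof -
  have "\<exists>n ws. length ws = n \<and> set ws \<subseteq> S \<and> foldr (\<otimes>) ws \<one> = g"
    using ex_word[OF assms] by blast
  from LeastI_ex[OF this] show ?thesis
    using that unfolding word_length_def by blast
qed

lemma word_length_one [simp]: "word_length G S \<one> = 0"
  using word_length_le[of "[]"] by simp

lemma word_length_mult_le:
  assumes "g \<in> carrier G" "h \<in> carrier G"
  shows "word_length G S (g \<otimes> h) \<le> word_length G S g + word_length G S h"
proof -
  obtain us vs where "set us \<subseteq> S" "foldr (\<otimes>) us \<one> = g" "length us = word_length G S g"
    "set vs \<subseteq> S" "foldr (\<otimes>) vs \<one> = h" "length vs = word_length G S h"
    using assms by (metis geodesic_word)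
  then show ?thesis
    using word_length_le[of "us @ vs"] foldr_mult_append[of us vs] S_carrier
    by (auto simp del: foldr_append)
qed

lemma word_length_inv_le:
  assumes "g \<in> carrier G"
  shows "word_length G S (inv g) \<le> word_length G S g"
proof -
  obtain ws where ws: "set ws \<subseteq> S" "foldr (\<otimes>) ws \<one> = g" "length ws = word_length G S g"
    using geodesic_word[OF assms] .
  then have "set (rev (map (m_inv G) ws)) \<subseteq> S" using inv_S by auto
  from word_length_le[OF this] show ?thesis
    using ws S_carrier foldr_mult_inv[of ws] by auto
qed

lemma word_length_inv:
  assumes "g \<in> carrier G"
  shows "word_length G S (inv g) = word_length G S g"
  using word_length_inv_le[of g] word_length_inv_le[of "inv g"] assms by simp

lemma word_metric_one:
  assumes "g \<in> carrier G"
  shows "word_metric G S g \<one> = len g"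
  using assms by (simp add: word_metric_def word_length_inv)

text \<open>The reverse triangle inequality. For fixed \<open>g\<close> the difference is bounded in
  \<open>x\<close> although the length itself need not be.\<close>

lemma abs_len_mult_diff_le:
  assumes "g \<in> carrier G" "x \<in> carrier G"
  shows "\<bar>len (g \<otimes> x) - len x\<bar> \<le> len g"
proof -
  have "word_length G S x \<le> word_length G S (inv g) + word_length G S (g \<otimes> x)"
    using word_length_mult_le[of "inv g" "g \<otimes> x"] assms by (simp add: m_assoc[symmetric])
  then show ?thesis
    using word_length_mult_le[OF assms] assms by (simp add: word_length_inv abs_le_iff)
qed

text \<open>The reference measure is the law of a random word of geometric length with independent
  uniform letters; the identity is added as a letter because \<open>S\<close> may be empty.\<close>

lemma ex_pmf_exponential_decay:
  "\<exists>q K. K \<ge> 0 \<and> (\<forall>g\<in>carrier G. g \<in> set_pmf q \<and> - ln (pmf q g) \<le> K * (len g + 1))"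
proof -
  define T where "T = insert \<one> S"
  define \<sigma> where "\<sigma> = pmf_of_set T"
  define q where "q = bind_pmf (geometric_pmf (1 / 2)) (conv_power G \<sigma>)"
  \<comment> \<open>Each letter of a word costs a factor \<open>1 / card T\<close> for its choice
    and a factor \<open>1 / 2\<close> for prolonging the geometric length.\<close>
  define b where "b = 1 / (2 * real (card T))"
  have T: "finite T" "T \<noteq> {}" using finite_S by (auto simp: T_def)
  then have card: "real (card T) \<ge> 1" by (simp add: Suc_leI card_gt_0_iff)
  then have b: "0 < b" "b \<le> 1 / 2" by (auto simp: b_def field_simps)
  have word: "(1 / real (card T)) ^ length ws \<le> pmf (conv_power G \<sigma> (length ws)) (foldr (\<otimes>) ws \<one>)"
    if "set ws \<subseteq> T" for ws
    using that
  proof (induction ws)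
    case (Cons w ws)
    then have "pmf \<sigma> w = 1 / real (card T)" using T by (simp add: \<sigma>_def)
    then have "(1 / real (card T)) ^ length (w # ws)
        \<le> pmf \<sigma> w * pmf (conv_power G \<sigma> (length ws)) (foldr (\<otimes>) ws \<one>)"
      using Cons by (auto intro!: mult_left_mono divide_right_mono)
    also have "\<dots> \<le> pmf (conv_power G \<sigma> (length (w # ws))) (foldr (\<otimes>) (w # ws) \<one>)"
      using pmf_mult_le_pmf_convolution by simp
    finally show ?case .
  qed simp
  have "g \<in> set_pmf q \<and> - ln (pmf q g) \<le> - ln b * (len g + 1)" if g: "g \<in> carrier G" for g
  proof -
    obtain ws where ws: "set ws \<subseteq> S" "foldr (\<otimes>) ws \<one> = g" "length ws = word_length G S g"
      using geodesic_word[OF g] .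
    let ?n = "word_length G S g"
    \<comment> \<open>The extra power of \<open>b\<close> absorbs the factor \<open>1 / 2\<close>
      for stopping at length \<open>?n\<close>.\<close>
    have "b ^ (?n + 1) \<le> b ^ ?n * (1 / 2)"
      using b by (simp add: mult.commute)
    also have "b ^ ?n = (1 / 2) ^ ?n * (1 / real (card T)) ^ ?n"
      by (simp add: b_def power_mult_distrib[symmetric])
    also have "\<dots> * (1 / 2) = pmf (geometric_pmf (1 / 2)) ?n * (1 / real (card T)) ^ ?n"
      by simp
    also have "\<dots> \<le> pmf (geometric_pmf (1 / 2)) ?n * pmf (conv_power G \<sigma> ?n) g"
      using word[of ws] ws by (intro mult_left_mono) (auto simp: T_def)
    also have "\<dots> \<le> pmf q g"
      unfolding q_def by (rule pmf_mult_le_pmf_bind)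
    finally have ge: "b ^ (?n + 1) \<le> pmf q g" .
    moreover have "0 < b ^ (?n + 1)" using b by simp
    ultimately have pos: "0 < pmf q g" by linarith
    have "ln (b ^ (?n + 1)) \<le> ln (pmf q g)" using ge \<open>0 < b ^ (?n + 1)\<close> pos by (subst ln_le_cancel_iff)
    then show ?thesis using pos b by (simp add: ln_realpow pmf_positive_iff algebra_simps ln_mult)
  qed
  moreover have "- ln b \<ge> 0" using b by simp
  ultimately show ?thesis by blast
qed

text \<open>The triangle inequality is integrated as a nonnegative integral, so that finiteness and
  the bound on the mean come out together.\<close>

lemma integrable_len_convolution:
  assumes p: "set_pmf p \<subseteq> carrier G" "integrable p len"
    and q: "set_pmf q \<subseteq> carrier G" "integrable q len"
  shows "integrable (convolution_pmf G p q) len" (is ?A)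
    and "measure_pmf.expectation (convolution_pmf G p q) len
      \<le> measure_pmf.expectation p len + measure_pmf.expectation q len" (is ?B)
proof -
  have "(\<integral>\<^sup>+x. ennreal (len x) \<partial>convolution_pmf G p q)
      = (\<integral>\<^sup>+s. (\<integral>\<^sup>+x. ennreal (len (s \<otimes> x)) \<partial>q) \<partial>p)"
    by (simp add: convolution_pmf_bind)
  also have "\<dots> \<le> (\<integral>\<^sup>+s. (\<integral>\<^sup>+x. ennreal (len s) + ennreal (len x) \<partial>q) \<partial>p)"
  proof (rule nn_integral_mono_AE, unfold AE_measure_pmf_iff, safe,
      rule nn_integral_mono_AE, unfold AE_measure_pmf_iff, safe)
    fix s x assume "s \<in> set_pmf p" "x \<in> set_pmf q"
    then have "len (s \<otimes> x) \<le> len s + len x"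
      using word_length_mult_le[of s x] p q by (auto simp: subset_iff)
    then show "ennreal (len (s \<otimes> x)) \<le> ennreal (len s) + ennreal (len x)"
      by (simp add: ennreal_plus[symmetric] del: ennreal_plus)
  qed
  also have "\<dots> = (\<integral>\<^sup>+s. ennreal (len s) \<partial>p) + (\<integral>\<^sup>+x. ennreal (len x) \<partial>q)"
    by (simp add: nn_integral_add)
  also have "\<dots> = ennreal (measure_pmf.expectation p len + measure_pmf.expectation q len)"
    using nn_integral_eq_integral[OF p(2)] nn_integral_eq_integral[OF q(2)] by simp
  finally have le: "(\<integral>\<^sup>+x. ennreal (len x) \<partial>convolution_pmf G p q)
    \<le> ennreal (measure_pmf.expectation p len + measure_pmf.expectation q len)" .
  show ?A
    using le_less_trans[OF le ennreal_less_top] by (intro integrableI_nonneg) auto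
  then show ?B
    using le nn_integral_eq_integral[of "convolution_pmf G p q" len] by (simp del: ennreal_plus)
qed

text \<open>Gibbs' inequality against the reference measure: its negative logarithm is at most
  linear in the length, with a constant independent of \<open>p\<close>.\<close>

lemma ex_entropy_bound:
  "\<exists>K\<ge>0. \<forall>p. set_pmf p \<subseteq> carrier G \<longrightarrow> integrable p len \<longrightarrow>
     entropy_pmf p \<le> ennreal (K * (measure_pmf.expectation p len + 1))"
proof -
  obtain q K where K: "K \<ge> 0"
    and q: "\<And>g. g \<in> carrier G \<Longrightarrow> g \<in> set_pmf q \<and> - ln (pmf q g) \<le> K * (len g + 1)"
    using ex_pmf_exponential_decay by blast
  have "entropy_pmf p \<le> ennreal (K * (measure_pmf.expectation p len + 1))"
    if p: "set_pmf p \<subseteq> carrier G" "integrable p len" for p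
  proof -
    have "entropy_pmf p \<le> (\<integral>\<^sup>+x. ennreal (- ln (pmf q x)) \<partial>p)"
      using p q by (intro entropy_pmf_le_cross_entropy) auto
    also have "\<dots> \<le> (\<integral>\<^sup>+x. ennreal (K * (len x + 1)) \<partial>p)"
      using p q by (intro nn_integral_mono_AE) (auto simp: AE_measure_pmf_iff intro!: ennreal_leI)
    also have "\<dots> = ennreal (measure_pmf.expectation p (\<lambda>x. K * (len x + 1)))"
      using p K by (intro nn_integral_eq_integral) auto
    also have "measure_pmf.expectation p (\<lambda>x. K * (len x + 1)) = K * (measure_pmf.expectation p len + 1)"
      using p by simp
    finally show ?thesis .
  qed
  with K show ?thesis by blast
qed

end

section \<open>Random walks\<close>

locale random_walk = measured_group G \<mu> + finitely_generated_group G S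
  for G (structure) and \<mu> :: "'a pmf" and S :: "'a set" +
  assumes first_moment: "integrable \<mu> len"
begin

abbreviation walk :: "nat \<Rightarrow> 'a pmf" where "walk n \<equiv> conv_power G \<mu> n"

abbreviation mean_len :: "nat \<Rightarrow> real" where "mean_len n \<equiv> measure_pmf.expectation (walk n) len"

lemma walk_carrier: "x \<in> set_pmf (walk n) \<Longrightarrow> x \<in> carrier G"
  using set_conv_power[OF support_carrier] by auto

lemma integrable_len_walk: "integrable (walk n) len"
proof (induction n)
  case (Suc n)
  then show ?case
    using integrable_len_convolution(1) support_carrier first_moment set_conv_power[OF support_carrier]
    by simp
qed (simp add: integrable_measure_pmf_finite)

text \<open>The drift is defined through \<open>lim\<close>, whose value is informative only once
  convergence is known.\<close>

lemma convergent_mean_len: "convergent (\<lambda>n. 1 / real n * mean_len n)"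
proof (rule subadditive_convergent)
  show "mean_len (m + n) \<le> mean_len m + mean_len n" for m n
    unfolding conv_power_add[OF support_carrier]
    by (intro integrable_len_convolution(2) integrable_len_walk set_conv_power support_carrier)
qed simp

lemma drift_word_metric: "drift G (word_metric G S) \<mu> = lim (\<lambda>n. 1 / real n * mean_len n)"
proof -
  have "measure_pmf.expectation (walk n) (\<lambda>g. word_metric G S g \<one>) = mean_len n" for n
    by (intro integral_cong_AE) (auto simp: AE_measure_pmf_iff word_metric_one walk_carrier)
  then show ?thesis by (simp add: drift_def)
qed

section \<open>Bounded harmonic functions of a walk with zero drift\<close>

text \<open>Induction on \<open>n\<close> by conditioning on the first step. Harmonicity is taken
  here with respect to right multiplication, which corresponds to \<open>left_harmonic\<close> after
  inversion.\<close>

lemma harmonic_walk: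
  fixes u :: "'a \<Rightarrow> real"
  assumes B: "\<And>x. \<bar>u x\<bar> \<le> B"
    and harm: "\<And>h. h \<in> carrier G \<Longrightarrow> u h = measure_pmf.expectation \<mu> (\<lambda>s. u (h \<otimes> s))"
    and h: "h \<in> carrier G"
  shows "measure_pmf.expectation (walk n) (\<lambda>x. u (h \<otimes> x)) = u h"
  using h
proof (induction n arbitrary: h)
  case (Suc n)
  have "measure_pmf.expectation (walk (Suc n)) (\<lambda>x. u (h \<otimes> x))
      = measure_pmf.expectation \<mu> (\<lambda>s. measure_pmf.expectation (walk n) (\<lambda>x. u (h \<otimes> (s \<otimes> x))))"
    unfolding conv_power.simps convolution_pmf_bind
    by (subst integral_bind_pmf_bounded[where B=B]) (auto simp: B)
  also have "\<dots> = measure_pmf.expectation \<mu> (\<lambda>s. u (h \<otimes> s))"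
  proof (intro integral_cong_AE)
    show "AE s in \<mu>. measure_pmf.expectation (walk n) (\<lambda>x. u (h \<otimes> (s \<otimes> x))) = u (h \<otimes> s)"
      unfolding AE_measure_pmf_iff
    proof
      fix s assume s: "s \<in> set_pmf \<mu>"
      then have "s \<in> carrier G" using support_carrier by auto
      then have "measure_pmf.expectation (walk n) (\<lambda>x. u (h \<otimes> (s \<otimes> x)))
          = measure_pmf.expectation (walk n) (\<lambda>x. u ((h \<otimes> s) \<otimes> x))"
        using Suc.prems
        by (intro integral_cong_AE) (auto simp: AE_measure_pmf_iff m_assoc walk_carrier)
      then show "measure_pmf.expectation (walk n) (\<lambda>x. u (h \<otimes> (s \<otimes> x))) = u (h \<otimes> s)"
        using Suc \<open>s \<in> carrier G\<close> by simp
    qed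
  qed auto
  finally show ?case using harm[OF Suc.prems] by simp
qed simp

text \<open>If the step \<open>s\<close> changed \<open>u\<close> at \<open>h\<close>, the entropy
  of the walk would grow at least linearly, whereas it is bounded by a multiple of the mean length
  plus one.\<close>

lemma harmonic_step_invariant:
  fixes u :: "'a \<Rightarrow> real"
  assumes drift: "(\<lambda>n. 1 / real n * mean_len n) \<longlonglongrightarrow> 0"
    and B: "\<And>x. \<bar>u x\<bar> \<le> B"
    and harm: "\<And>h. h \<in> carrier G \<Longrightarrow> u h = measure_pmf.expectation \<mu> (\<lambda>s. u (h \<otimes> s))"
    and h: "h \<in> carrier G" and s: "s \<in> set_pmf \<mu>"
  shows "u (h \<otimes> s) = u h"
proof (rule ccontr)
  assume "u (h \<otimes> s) \<noteq> u h"
  define \<delta> where "\<delta> = u (h \<otimes> s) - u h"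
  define F where "F = (\<lambda>x. u (h \<otimes> x) - u h)"
  \<comment> \<open>\<open>2 * B\<close> already bounds \<open>F\<close>; adding \<open>1\<close>
    keeps the denominator positive when \<open>B = 0\<close>.\<close>
  define C where "C = 2 * B + 1"
  define c where "c = pmf \<mu> s * (\<delta>\<^sup>2 / (8 * C\<^sup>2))"
  have C: "\<bar>F x\<bar> \<le> C" "0 < C" for x
    using B[of "h \<otimes> x"] B[of h] unfolding F_def C_def by linarith+
  have sG: "s \<in> carrier G" using s support_carrier by auto
  have "c > 0"
    using s C(2) \<open>u (h \<otimes> s) \<noteq> u h\<close> by (auto simp: c_def \<delta>_def pmf_positive_iff)
  have int: "integrable (measure_pmf p) (\<lambda>x. u (f x))" for p :: "'a pmf" and f
    by (rule integrable_measure_pmf_bounded) (rule B)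
  \<comment> \<open>\<open>F\<close> has mean \<open>0\<close> under \<open>walk (Suc n)\<close> and
    mean \<open>\<delta>\<close> under the translate of \<open>walk n\<close> by \<open>s\<close>.
    The gain \<open>c\<close> is the same for all \<open>n\<close>.\<close>
  have step: "entropy_pmf (walk n) + ennreal c \<le> entropy_pmf (walk (Suc n))" for n
    unfolding c_def conv_power.simps convolution_pmf_bind
  proof (rule entropy_pmf_mixture_gain[OF _ C(1) C(2) _ _ s])
    fix t assume "t \<in> set_pmf \<mu>"
    then have "t \<in> carrier G" using support_carrier by auto
    then have "inj_on (\<lambda>x. t \<otimes> x) (set_pmf (walk n))"
      by (auto simp: inj_on_def walk_carrier)
    then show "entropy_pmf (map_pmf (\<lambda>x. t \<otimes> x) (walk n)) = entropy_pmf (walk n)"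
      by (rule entropy_pmf_map_inj)
  next
    show "measure_pmf.expectation (\<mu> \<bind> (\<lambda>s. map_pmf ((\<otimes>) s) (walk n))) F = 0"
      using harmonic_walk[OF B harm h, of "Suc n"] by (simp add: F_def int convolution_pmf_bind)
  next
    have "measure_pmf.expectation (walk n) (\<lambda>x. u (h \<otimes> (s \<otimes> x)))
        = measure_pmf.expectation (walk n) (\<lambda>x. u ((h \<otimes> s) \<otimes> x))"
      using h sG by (intro integral_cong_AE) (auto simp: AE_measure_pmf_iff m_assoc walk_carrier)
    also have "\<dots> = u (h \<otimes> s)" using h sG by (intro harmonic_walk[OF B harm]) auto
    finally show "measure_pmf.expectation (map_pmf ((\<otimes>) s) (walk n)) F = \<delta>"
      by (simp add: F_def int \<delta>_def)
  qed
  have lower: "ennreal (real n * c) \<le> entropy_pmf (walk n)" for n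
  proof (induction n)
    case (Suc n)
    have "ennreal (real (Suc n) * c) = ennreal (real n * c) + ennreal c"
      using \<open>c > 0\<close> by (simp add: ennreal_plus[symmetric] algebra_simps del: ennreal_plus)
    also have "\<dots> \<le> entropy_pmf (walk n) + ennreal c" by (intro add_right_mono Suc)
    also have "\<dots> \<le> entropy_pmf (walk (Suc n))" by (rule step)
    finally show ?case .
  qed simp
  obtain K where K: "K \<ge> 0" "\<And>p. set_pmf p \<subseteq> carrier G \<Longrightarrow> integrable p len \<Longrightarrow>
     entropy_pmf p \<le> ennreal (K * (measure_pmf.expectation p len + 1))"
    using ex_entropy_bound by blast
  have "real n * c \<le> K * (mean_len n + 1)" for n
  proof -
    have "ennreal (real n * c) \<le> ennreal (K * (mean_len n + 1))"
      using lower[of n] K(2)[OF set_conv_power[OF support_carrier] integrable_len_walk, of n]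
      by (rule order_trans)
    moreover have "0 \<le> K * (mean_len n + 1)" using K(1) by simp
    ultimately show ?thesis by (simp only: ennreal_le_iff)
  qed
  \<comment> \<open>After division by \<open>n\<close> the right-hand side tends to
    \<open>0\<close>, contradicting \<open>c > 0\<close>.\<close>
  then have "c \<le> K * (1 / real n * mean_len n + 1 / real n)" if "n \<ge> 1" for n
    using that by (simp add: field_simps)
  then have "eventually (\<lambda>n. c \<le> K * (1 / real n * mean_len n + 1 / real n)) sequentially"
    by (intro eventually_sequentiallyI[of 1])
  moreover have "(\<lambda>n. K * (1 / real n * mean_len n + 1 / real n)) \<longlonglongrightarrow> K * (0 + 0)"
    by (intro tendsto_intros drift lim_1_over_n)
  ultimately have "c \<le> K * (0 + 0)"
    by (intro tendsto_lowerbound) auto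
  with \<open>c > 0\<close> show False by simp
qed

text \<open>Invariance under right multiplication by support elements passes to products, and the
  support generates the group as a semigroup.\<close>

lemma harmonic_constant:
  fixes u :: "'a \<Rightarrow> real"
  assumes drift: "(\<lambda>n. 1 / real n * mean_len n) \<longlonglongrightarrow> 0"
    and B: "\<And>x. \<bar>u x\<bar> \<le> B"
    and harm: "\<And>h. h \<in> carrier G \<Longrightarrow> u h = measure_pmf.expectation \<mu> (\<lambda>s. u (h \<otimes> s))"
    and a: "a \<in> carrier G"
  shows "u a = u \<one>"
proof -
  have sub: "semigroup_generate G (set_pmf \<mu>) = carrier G" by (rule support_generates)
  have "a \<in> semigroup_generate G (set_pmf \<mu>)" using a sub by simp
  then have "u (h \<otimes> a) = u h" if "h \<in> carrier G" for h
    using that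
  proof (induction arbitrary: h)
    case (incl a)
    then show ?case by (intro harmonic_step_invariant[OF drift B harm])
  next
    case (mult a b)
    then have "a \<in> carrier G" "b \<in> carrier G" using sub by auto
    then show ?case using mult.IH(1)[of h] mult.IH(2)[of "h \<otimes> a"] mult.prems
      by (simp add: m_assoc)
  qed
  from this[of \<one>] show ?thesis using a by simp
qed

text \<open>The dictionary between the two conventions: inverting the argument turns left
  multiplication by steps of the reflected measure into right multiplication by steps of
  \<open>\<mu>\<close>.\<close>

lemma integral_reflected_inv:
  fixes f :: "'a \<Rightarrow> 'c::{banach, second_countable_topology}"
  assumes "h \<in> carrier G"
  shows "measure_pmf.expectation (reflected G \<mu>) (\<lambda>s. f (s \<otimes> inv h))
    = measure_pmf.expectation \<mu> (\<lambda>s. f (inv (h \<otimes> s)))"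
  unfolding reflected_def integral_map_pmf using assms support_carrier
  by (intro integral_cong_AE) (auto simp: AE_measure_pmf_iff inv_mult_group)

lemma liouville_if_zero_drift:
  assumes drift: "(\<lambda>n. 1 / real n * mean_len n) \<longlonglongrightarrow> 0"
  shows "liouville G \<mu>"
  unfolding liouville_def
proof (intro allI impI)
  fix f assume bdd: "bounded (f ` carrier G)" and harm: "left_harmonic G \<mu> f"
  obtain B where B: "\<And>x. x \<in> carrier G \<Longrightarrow> norm (f x) \<le> B"
    using bdd by (auto simp: bounded_iff)
  have B0: "0 \<le> B" using B[OF one_closed] norm_ge_zero order_trans by blast
  have harm': "f (inv h) = measure_pmf.expectation \<mu> (\<lambda>s. f (inv (h \<otimes> s)))" if "h \<in> carrier G" for h
    using harm that unfolding left_harmonic_def by (simp add: integral_reflected_inv)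
  have int: "integrable \<mu> (\<lambda>s. f (inv (h \<otimes> s)))" if "h \<in> carrier G" for h
    by (rule measure_pmf.integrable_const_bound[where B=B])
      (use that support_carrier B in \<open>auto simp: AE_measure_pmf_iff subset_iff\<close>)
  \<comment> \<open>\<open>r\<close> stands for the real and imaginary parts, since the entropy
    argument treats real functions.\<close>
  have const: "r (f x) = r (f \<one>)"
    if r: "bounded_linear r" "\<And>z. \<bar>r z\<bar> \<le> norm z" and x: "x \<in> carrier G" for r :: "complex \<Rightarrow> real" and x
  proof -
    \<comment> \<open>The value \<open>0\<close> off the carrier makes \<open>u\<close> bounded on
      the whole type; \<open>f\<close> is controlled only on the carrier.\<close>
    define u where "u = (\<lambda>h. if h \<in> carrier G then r (f (inv h)) else 0)"
    have "u (inv x) = u \<one>"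
    proof (rule harmonic_constant[OF drift])
      show "\<bar>u y\<bar> \<le> B" for y
        using r(2)[of "f (inv y)"] B[of "inv y"] B0 by (auto simp: u_def)
      fix h assume h: "h \<in> carrier G"
      have "r (f (inv h)) = measure_pmf.expectation \<mu> (\<lambda>s. r (f (inv (h \<otimes> s))))"
        using harm'[OF h] integral_bounded_linear[OF r(1) int[OF h]] by simp
      also have "\<dots> = measure_pmf.expectation \<mu> (\<lambda>s. u (h \<otimes> s))"
        using h support_carrier
        by (intro integral_cong_AE) (auto simp: AE_measure_pmf_iff u_def subset_iff)
      finally show "u h = measure_pmf.expectation \<mu> (\<lambda>s. u (h \<otimes> s))" using h by (simp add: u_def)
    qed (use x in auto)
    then show ?thesis using x by (simp add: u_def)
  qed
  have "f x = f \<one>" if "x \<in> carrier G" for x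
    using const[OF bounded_linear_Re abs_Re_le_cmod that] const[OF bounded_linear_Im abs_Im_le_cmod that]
    by (rule complex_eqI)
  then show "f constant_on carrier G" unfolding constant_on_def by blast
qed

subsection \<open>The limiting homomorphism\<close>

text \<open>An averaged horofunction: the expected change in the length of the walk at time
  \<open>n\<close> under left translation by \<open>g\<close>.\<close>

definition increment :: "nat \<Rightarrow> 'a \<Rightarrow> real" where
  "increment n g = measure_pmf.expectation (walk n) (\<lambda>x. len (g \<otimes> x) - len x)"

text \<open>Averaging over time makes the shift from \<open>n\<close> to \<open>Suc n\<close>
  negligible, so limits become exactly harmonic.\<close>

definition mean_increment :: "nat \<Rightarrow> 'a \<Rightarrow> real" where
  "mean_increment N g = 1 / real N * (\<Sum>n<N. increment n g)"

lemma increment_le: "g \<in> carrier G \<Longrightarrow> \<bar>increment n g\<bar> \<le> len g"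
  unfolding increment_def
  by (intro abs_integral_measure_pmf_le abs_len_mult_diff_le) (auto intro: walk_carrier)

lemma mean_increment_le:
  assumes "g \<in> carrier G"
  shows "\<bar>mean_increment N g\<bar> \<le> len g"
proof (cases "N = 0")
  case False
  have "\<bar>\<Sum>n<N. increment n g\<bar> \<le> (\<Sum>n<N. len g)"
    by (rule order_trans[OF sum_abs]) (intro sum_mono increment_le assms)
  then show ?thesis using False by (simp add: mean_increment_def abs_mult field_simps)
qed (simp add: mean_increment_def)

lemma integrable_increment:
  assumes "g \<in> carrier G"
  shows "integrable (walk n) (\<lambda>x. len (g \<otimes> x) - len x)"
  using assms
  by (intro measure_pmf.integrable_const_bound[where B="len g"])
    (auto simp: AE_measure_pmf_iff abs_len_mult_diff_le walk_carrier)

lemma increment_mult: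
  assumes g: "g \<in> carrier G" and h: "h \<in> carrier G"
  shows "increment n (g \<otimes> h) - increment n h
    = measure_pmf.expectation (walk n) (\<lambda>x. len (g \<otimes> (h \<otimes> x)) - len (h \<otimes> x))"
proof -
  have "increment n (g \<otimes> h) - increment n h = measure_pmf.expectation (walk n)
      (\<lambda>x. (len ((g \<otimes> h) \<otimes> x) - len x) - (len (h \<otimes> x) - len x))"
    unfolding increment_def using assms
    by (intro Bochner_Integration.integral_diff[symmetric] integrable_increment) auto
  also have "\<dots> = measure_pmf.expectation (walk n) (\<lambda>x. len (g \<otimes> (h \<otimes> x)) - len (h \<otimes> x))"
    using assms by (intro integral_cong_AE) (auto simp: AE_measure_pmf_iff m_assoc walk_carrier)
  finally show ?thesis .
qed

text \<open>Averaging over one further step of \<open>\<mu>\<close> turns the walk at time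
  \<open>n\<close> into the walk at time \<open>Suc n\<close>. The differences are thus harmonic up
  to a shift in time.\<close>

lemma increment_mult_step:
  assumes g: "g \<in> carrier G" and h: "h \<in> carrier G"
  shows "measure_pmf.expectation \<mu> (\<lambda>s. increment n (g \<otimes> (h \<otimes> s)) - increment n (h \<otimes> s))
    = increment (Suc n) (g \<otimes> h) - increment (Suc n) h"
proof -
  \<comment> \<open>Cutting off outside the carrier yields the global bound that iterated
    expectation asks for.\<close>
  define F where "F = (\<lambda>x. if x \<in> carrier G then len (g \<otimes> x) - len x else 0)"
  have F: "\<bar>F x\<bar> \<le> len g" for x
    using abs_len_mult_diff_le[OF g] by (simp add: F_def)
  have "increment (Suc n) (g \<otimes> h) - increment (Suc n) h
      = measure_pmf.expectation (walk (Suc n)) (\<lambda>x. F (h \<otimes> x))"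
    unfolding increment_mult[OF assms] using h walk_carrier[of _ "Suc n"]
    by (intro integral_cong_AE) (auto simp: AE_measure_pmf_iff F_def simp del: conv_power.simps)
  also have "\<dots> = measure_pmf.expectation \<mu>
      (\<lambda>s. measure_pmf.expectation (walk n) (\<lambda>x. F (h \<otimes> (s \<otimes> x))))"
    unfolding conv_power.simps convolution_pmf_bind
    by (subst integral_bind_pmf_bounded[where B="len g"]) (auto simp: F)
  also have "\<dots> = measure_pmf.expectation \<mu> (\<lambda>s. increment n (g \<otimes> (h \<otimes> s)) - increment n (h \<otimes> s))"
  proof (intro integral_cong_AE)
    show "AE s in \<mu>. measure_pmf.expectation (walk n) (\<lambda>x. F (h \<otimes> (s \<otimes> x)))
        = increment n (g \<otimes> (h \<otimes> s)) - increment n (h \<otimes> s)"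
      unfolding AE_measure_pmf_iff
    proof
      fix s assume "s \<in> set_pmf \<mu>"
      then have s: "s \<in> carrier G" using support_carrier by auto
      have "increment n (g \<otimes> (h \<otimes> s)) - increment n (h \<otimes> s)
          = measure_pmf.expectation (walk n) (\<lambda>x. len (g \<otimes> ((h \<otimes> s) \<otimes> x)) - len ((h \<otimes> s) \<otimes> x))"
        using h s by (intro increment_mult g) auto
      also have "\<dots> = measure_pmf.expectation (walk n) (\<lambda>x. F (h \<otimes> (s \<otimes> x)))"
        using h s by (intro integral_cong_AE) (auto simp: AE_measure_pmf_iff F_def m_assoc walk_carrier)
      finally show "measure_pmf.expectation (walk n) (\<lambda>x. F (h \<otimes> (s \<otimes> x)))
        = increment n (g \<otimes> (h \<otimes> s)) - increment n (h \<otimes> s)" by simp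
    qed
  qed auto
  finally show ?thesis by simp
qed

lemma integrable_dominated_len:
  assumes "\<And>s. s \<in> carrier G \<Longrightarrow> \<bar>f s\<bar> \<le> len s"
  shows "integrable \<mu> f"
  using assms support_carrier
  by (intro Bochner_Integration.integrable_bound[OF first_moment]) (auto simp: AE_measure_pmf_iff)

text \<open>First-step decomposition of the walk. As \<open>len\<close> may be unbounded, the
  nonnegative form of iterated expectation is used.\<close>

lemma expectation_increment:
  "measure_pmf.expectation \<mu> (increment n) = mean_len (Suc n) - mean_len n"
proof -
  have eq: "measure_pmf.expectation (walk n) (\<lambda>x. len (s \<otimes> x)) = increment n s + mean_len n"
    if "s \<in> carrier G" for s
    using Bochner_Integration.integral_add[OF integrable_increment[OF that] integrable_len_walk]
    by (simp add: increment_def)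
  have "integrable (bind_pmf \<mu> (\<lambda>s. map_pmf (\<lambda>x. s \<otimes> x) (walk n))) len"
    using integrable_len_walk[of "Suc n"] by (simp add: convolution_pmf_bind)
  from integral_bind_pmf_nonneg(2)[OF this]
  have "mean_len (Suc n)
      = measure_pmf.expectation \<mu> (\<lambda>s. measure_pmf.expectation (walk n) (\<lambda>x. len (s \<otimes> x)))"
    by (simp add: convolution_pmf_bind)
  also have "\<dots> = measure_pmf.expectation \<mu> (\<lambda>s. increment n s + mean_len n)"
    using support_carrier by (intro integral_cong_AE) (auto simp: AE_measure_pmf_iff eq)
  also have "\<dots> = measure_pmf.expectation \<mu> (increment n) + mean_len n"
    using integrable_dominated_len[OF increment_le] by simp
  finally show ?thesis by simp
qed

text \<open>The increments telescope, and \<open>mean_len 0 = 0\<close>.\<close>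

lemma expectation_mean_increment:
  "measure_pmf.expectation \<mu> (mean_increment N) = 1 / real N * mean_len N"
proof -
  have "measure_pmf.expectation \<mu> (mean_increment N)
      = 1 / real N * (\<Sum>n<N. measure_pmf.expectation \<mu> (increment n))"
    unfolding mean_increment_def[abs_def]
    by (subst integral_mult_right_zero, subst Bochner_Integration.integral_sum)
      (auto intro!: integrable_dominated_len increment_le)
  also have "(\<Sum>n<N. measure_pmf.expectation \<mu> (increment n)) = mean_len N"
    unfolding expectation_increment using sum_lessThan_telescope[of mean_len N]
    by (simp del: conv_power.simps(2))
  finally show ?thesis .
qed

lemma abs_increment_mult_diff_le:
  assumes "g \<in> carrier G" "h \<in> carrier G"
  shows "\<bar>increment n (g \<otimes> h) - increment n h\<bar> \<le> len g"
  unfolding increment_mult[OF assms] using assms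
  by (intro abs_integral_measure_pmf_le abs_len_mult_diff_le) (auto simp: walk_carrier)

text \<open>Harmonicity up to an error of order \<open>1 / N\<close>: the time shifts telescope,
  leaving two boundary terms of absolute value at most \<open>len g\<close>.\<close>

lemma mean_increment_mult_step:
  assumes g: "g \<in> carrier G" and h: "h \<in> carrier G"
  shows "\<bar>measure_pmf.expectation \<mu> (\<lambda>s. mean_increment N (g \<otimes> (h \<otimes> s)) - mean_increment N (h \<otimes> s))
    - (mean_increment N (g \<otimes> h) - mean_increment N h)\<bar> \<le> 1 / real N * (2 * len g)"
proof -
  define d where "d = (\<lambda>n h. increment n (g \<otimes> h) - increment n h)"
  have d: "\<bar>d n x\<bar> \<le> len g" if "x \<in> carrier G" for n x
    unfolding d_def using abs_increment_mult_diff_le[OF g that] .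
  have mean: "mean_increment N (g \<otimes> x) - mean_increment N x = 1 / real N * (\<Sum>n<N. d n x)" for x
    by (simp add: mean_increment_def d_def sum_subtractf right_diff_distrib diff_divide_distrib)
  have int: "integrable \<mu> (\<lambda>s. d n (h \<otimes> s))" for n
    by (rule measure_pmf.integrable_const_bound[where B="len g"])
      (use d h support_carrier in \<open>auto simp: AE_measure_pmf_iff subset_iff\<close>)
  have "measure_pmf.expectation \<mu> (\<lambda>s. mean_increment N (g \<otimes> (h \<otimes> s)) - mean_increment N (h \<otimes> s))
      = 1 / real N * (\<Sum>n<N. d (Suc n) h)"
    unfolding mean using increment_mult_step[OF assms] int
    by (subst integral_mult_right_zero, subst Bochner_Integration.integral_sum) (auto simp: d_def)
  then have "measure_pmf.expectation \<mu> (\<lambda>s. mean_increment N (g \<otimes> (h \<otimes> s)) - mean_increment N (h \<otimes> s))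
      - (mean_increment N (g \<otimes> h) - mean_increment N h) = 1 / real N * (\<Sum>n<N. d (Suc n) h - d n h)"
    by (simp add: mean sum_subtractf diff_divide_distrib)
  also have "(\<Sum>n<N. d (Suc n) h - d n h) = d N h - d 0 h"
    by (rule sum_lessThan_telescope)
  also have "\<bar>1 / real N * (d N h - d 0 h)\<bar> \<le> 1 / real N * (2 * len g)"
    unfolding abs_mult using d[OF h, of N] d[OF h, of 0] by (intro mult_mono) auto
  finally show ?thesis .
qed

section \<open>Vanishing of the drift in the Liouville case\<close>

lemma zero_drift_if_liouville:
  assumes sym: "symmetric_measure G \<mu>" and liouville: "liouville G \<mu>"
  shows "(\<lambda>n. 1 / real n * mean_len n) \<longlonglongrightarrow> 0"
proof -
  \<comment> \<open>A diagonal argument over the countable carrier. Division by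
    \<open>len g + 1\<close> provides the uniform bound \<open>1\<close>.\<close>
  obtain k where k: "strict_mono k"
    "\<And>g. g \<in> carrier G \<Longrightarrow> \<exists>l. (\<lambda>j. mean_increment (k j) g / (len g + 1)) \<longlonglongrightarrow> l"
  proof (rule function_convergent_subsequence[OF countable_carrier,
        of "\<lambda>N g. mean_increment N g / (len g + 1)" 1])
    show "norm (mean_increment N g / (len g + 1)) \<le> 1" if "g \<in> carrier G" for N g
      using mean_increment_le[OF that, of N] by simp
  next
    fix k :: "nat \<Rightarrow> nat"
    assume "strict_mono k"
      "\<And>g. g \<in> carrier G \<Longrightarrow> \<exists>l. (\<lambda>j. mean_increment (k j) g / (len g + 1)) \<longlonglongrightarrow> l"
    then show thesis by (rule that)
  qed
  have "\<exists>l. (\<lambda>j. mean_increment (k j) g) \<longlonglongrightarrow> l" if g: "g \<in> carrier G" for g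
  proof -
    obtain l where "(\<lambda>j. mean_increment (k j) g / (len g + 1)) \<longlonglongrightarrow> l"
      using k(2)[OF g] by blast
    then have "(\<lambda>j. (mean_increment (k j) g / (len g + 1)) * (len g + 1)) \<longlonglongrightarrow> l * (len g + 1)"
      by (intro tendsto_intros)
    moreover have "len g + 1 \<noteq> 0" using of_nat_0_le_iff[of "word_length G S g", where 'a=real] by linarith
    ultimately have "(\<lambda>j. mean_increment (k j) g) \<longlonglongrightarrow> l * (len g + 1)" by simp
    then show ?thesis by blast
  qed
  then obtain \<phi> where lim: "\<And>g. g \<in> carrier G \<Longrightarrow> (\<lambda>j. mean_increment (k j) g) \<longlonglongrightarrow> \<phi> g"
    by metis
  have \<phi>_le: "\<bar>\<phi> g\<bar> \<le> len g" if "g \<in> carrier G" for g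
    using tendsto_rabs[OF lim[OF that]] mean_increment_le[OF that] by (intro tendsto_upperbound) auto
  have diff_lim: "(\<lambda>j. mean_increment (k j) (g \<otimes> h) - mean_increment (k j) h) \<longlonglongrightarrow> \<phi> (g \<otimes> h) - \<phi> h"
    if "g \<in> carrier G" "h \<in> carrier G" for g h
    using that by (intro tendsto_diff lim) auto
  have mean_diff_le: "\<bar>mean_increment N (g \<otimes> h) - mean_increment N h\<bar> \<le> len g"
    if "g \<in> carrier G" "h \<in> carrier G" for N g h
  proof (cases "N = 0")
    case False
    have "\<bar>\<Sum>n<N. increment n (g \<otimes> h) - increment n h\<bar> \<le> (\<Sum>n<N. len g)"
      by (rule order_trans[OF sum_abs]) (intro sum_mono abs_increment_mult_diff_le that)
    then have "\<bar>1 / real N * (\<Sum>n<N. increment n (g \<otimes> h) - increment n h)\<bar> \<le> len g"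
      using False by (simp add: abs_mult field_simps)
    then show ?thesis by (simp add: mean_increment_def sum_subtractf diff_divide_distrib)
  qed (simp add: mean_increment_def)
  have diff_le: "\<bar>\<phi> (g \<otimes> h) - \<phi> h\<bar> \<le> len g" if "g \<in> carrier G" "h \<in> carrier G" for g h
    using tendsto_rabs[OF diff_lim[OF that]] mean_diff_le[OF that] by (intro tendsto_upperbound) auto
  have inv_k: "(\<lambda>j. 1 / real (k j)) \<longlonglongrightarrow> 0"
    using LIMSEQ_subseq_LIMSEQ[OF lim_1_over_n k(1)] by (simp add: o_def)
  \<comment> \<open>Dominated convergence with the constant \<open>len g\<close> computes the limit
    of \<open>?E\<close>, and the error of order \<open>1 / N\<close> vanishes along
    \<open>k\<close>; uniqueness of limits gives the identity.\<close>
  have harm: "measure_pmf.expectation \<mu> (\<lambda>s. \<phi> (g \<otimes> (h \<otimes> s)) - \<phi> (h \<otimes> s)) = \<phi> (g \<otimes> h) - \<phi> h"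
    if g: "g \<in> carrier G" and h: "h \<in> carrier G" for g h
  proof -
    let ?E = "\<lambda>j. measure_pmf.expectation \<mu>
      (\<lambda>s. mean_increment (k j) (g \<otimes> (h \<otimes> s)) - mean_increment (k j) (h \<otimes> s))"
    have "?E \<longlonglongrightarrow> measure_pmf.expectation \<mu> (\<lambda>s. \<phi> (g \<otimes> (h \<otimes> s)) - \<phi> (h \<otimes> s))"
      by (rule integral_dominated_convergence[where w="\<lambda>_. len g"])
        (use g h support_carrier diff_lim mean_diff_le in \<open>auto simp: AE_measure_pmf_iff subset_iff\<close>)
    moreover have "?E \<longlonglongrightarrow> \<phi> (g \<otimes> h) - \<phi> h"
    proof -
      have "(\<lambda>j. ?E j - (mean_increment (k j) (g \<otimes> h) - mean_increment (k j) h)) \<longlonglongrightarrow> 0"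
      proof (rule Lim_null_comparison)
        show "(\<lambda>j. 1 / real (k j) * (2 * len g)) \<longlonglongrightarrow> 0"
          using tendsto_mult_left_zero[OF inv_k] .
      qed (use mean_increment_mult_step[OF g h] in auto)
      from tendsto_add[OF this diff_lim[OF g h]] show ?thesis by simp
    qed
    ultimately show ?thesis by (rule LIMSEQ_unique)
  qed
  have \<phi>_one: "\<phi> \<one> = 0"
    using \<phi>_le[OF one_closed] by simp
  have hom: "\<phi> (g \<otimes> h) = \<phi> g + \<phi> h" if g: "g \<in> carrier G" and h: "h \<in> carrier G" for g h
  proof -
    \<comment> \<open>The inverses convert right harmonicity of the difference into
      \<open>left_harmonic\<close>.\<close>
    define f where "f = (\<lambda>x. complex_of_real (\<phi> (g \<otimes> inv x) - \<phi> (inv x)))"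
    have "bounded (f ` carrier G)"
      unfolding bounded_iff
      by (rule exI[of _ "len g"]) (use diff_le[OF g] in \<open>auto simp: f_def simp del: of_real_diff\<close>)
    moreover have "left_harmonic G \<mu> f"
      unfolding left_harmonic_def
    proof
      fix x assume x: "x \<in> carrier G"
      have "measure_pmf.expectation (reflected G \<mu>) (\<lambda>s. f (s \<otimes> x))
          = measure_pmf.expectation \<mu> (\<lambda>s. f (inv (inv x \<otimes> s)))"
        using integral_reflected_inv[of "inv x" f] x by simp
      also have "\<dots> = measure_pmf.expectation \<mu>
          (\<lambda>s. complex_of_real (\<phi> (g \<otimes> (inv x \<otimes> s)) - \<phi> (inv x \<otimes> s)))"
        using x support_carrier
        by (intro integral_cong_AE) (auto simp: AE_measure_pmf_iff f_def subset_iff)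
      also have "\<dots> = f x"
        unfolding integral_complex_of_real using harm[OF g, of "inv x"] x by (simp add: f_def)
      finally show "f x = measure_pmf.expectation (reflected G \<mu>) (\<lambda>s. f (s \<otimes> x))" by simp
    qed
    ultimately have "f constant_on carrier G" using liouville by (simp add: liouville_def)
    \<comment> \<open>These values are \<open>\<phi> (g \<otimes> h) - \<phi> h\<close> and
      \<open>\<phi> g - \<phi> \<one>\<close>, and \<open>\<phi> \<one> = 0\<close>.\<close>
    then have "f (inv h) = f \<one>" using h by (auto simp: constant_on_def)
    then show ?thesis using g h \<phi>_one by (simp add: f_def del: of_real_diff)
  qed
  \<comment> \<open>A homomorphism to the reals changes sign under inversion, so by symmetry its
    mean equals its own negative.\<close>
  have "measure_pmf.expectation \<mu> \<phi> = measure_pmf.expectation (reflected G \<mu>) \<phi>"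
    using sym by (simp add: symmetric_measure_def)
  also have "\<dots> = measure_pmf.expectation \<mu> (\<lambda>s. - \<phi> s)"
    unfolding reflected_def integral_map_pmf
  proof (intro integral_cong_AE)
    have "\<phi> (inv s) = - \<phi> s" if "s \<in> carrier G" for s
      using hom[of "inv s" s] that \<phi>_one by simp
    then show "AE s in \<mu>. \<phi> (inv s) = - \<phi> s"
      using support_carrier by (auto simp: AE_measure_pmf_iff)
  qed auto
  finally have zero: "measure_pmf.expectation \<mu> \<phi> = 0" by simp
  \<comment> \<open>The first moment supplies the dominating function \<open>len\<close>; the
    left-hand side is the normalised mean length along \<open>k\<close>.\<close>
  have "(\<lambda>j. measure_pmf.expectation \<mu> (mean_increment (k j))) \<longlonglongrightarrow> measure_pmf.expectation \<mu> \<phi>"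
    by (rule integral_dominated_convergence[OF _ _ first_moment])
      (use support_carrier lim mean_increment_le in \<open>auto simp: AE_measure_pmf_iff\<close>)
  then have sub: "((\<lambda>n. 1 / real n * mean_len n) \<circ> k) \<longlonglongrightarrow> 0"
    by (simp add: expectation_mean_increment zero o_def)
  obtain l where l: "(\<lambda>n. 1 / real n * mean_len n) \<longlonglongrightarrow> l"
    using convergent_mean_len by (auto simp: convergent_def)
  \<comment> \<open>The full sequence converges, so its limit can be read off along the subsequence
    \<open>k\<close>.\<close>
  then have "l = 0" using LIMSEQ_unique[OF LIMSEQ_subseq_LIMSEQ[OF l k(1)] sub] by simp
  with l show ?thesis by simp
qed

theorem drift_eq_0_iff_liouville:
  assumes "symmetric_measure G \<mu>"
  shows "drift G (word_metric G S) \<mu> = 0 \<longleftrightarrow> liouville G \<mu>"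
proof
  assume "drift G (word_metric G S) \<mu> = 0"
  then have "(\<lambda>n. 1 / real n * mean_len n) \<longlonglongrightarrow> 0"
    using convergent_mean_len by (simp add: drift_word_metric convergent_LIMSEQ_iff)
  then show "liouville G \<mu>" by (rule liouville_if_zero_drift)
next
  assume "liouville G \<mu>"
  then show "drift G (word_metric G S) \<mu> = 0"
    using zero_drift_if_liouville[OF assms] by (simp add: drift_word_metric limI)
qed

end

theorem theorem1p1:
  fixes G :: "('a, 'b) monoid_scheme" and \<mu> :: "'a pmf" and S :: "'a set"
  assumes "measured_group G \<mu>"
    and "symmetric_measure G \<mu>"
    and "finite S"
    and "symmetric_generating_set G S"
    and "integrable (measure_pmf \<mu>) (\<lambda>g. word_metric G S g \<one>\<^bsub>G\<^esub>)"
  shows "drift G (word_metric G S) \<mu> = 0 \<longleftrightarrow> liouville G \<mu>"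
proof -
  interpret measured_group G \<mu> by fact
  interpret finitely_generated_group G S
    by unfold_locales (fact assms)+
  \<comment> \<open>The metric measures the length of \<open>inv g\<close>, which is identified with
    \<open>len g\<close> on the carrier, hence almost everywhere.\<close>
  have "integrable \<mu> len \<longleftrightarrow> integrable \<mu> (\<lambda>g. word_metric G S g \<one>\<^bsub>G\<^esub>)"
    using support_carrier
    by (intro integrable_cong_AE) (auto simp: AE_measure_pmf_iff word_metric_one)
  then interpret random_walk G \<mu> S
    using assms(5) by unfold_locales simp
  show ?thesis using assms(2) by (rule drift_eq_0_iff_liouville)
qed

end
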